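(* For any $A,B,B',C,C'\in\widehat{\mathbb{F}_q}$ and any $x,y\in\mathbb{F}_q$, the following three identities hold: $$F_{2}(A;B,B';C,C';x,y)=F_{2}(A;B',B;C',C;y,x),$$ $$F_{2}(A;B,B';C,C';x,1)=B'C'(-1)\;{}_{3}F_2\left(\begin{matrix}A,B,A\overline{C'}\\ C,AB'\overline{C'}\end{matrix}\bigg|\,x\right),$$ $$F_{2}(A;B,B';C,C';1,y)=BC(-1)\;{}_{3}F_2\left(\begin{matrix}A,B',A\overline{C}\\ C',AB\overline{C}\end{matrix}\bigg|\,y\right).$$
   Context: Let $q$ be a power of a prime, $\mathbb{F}_q$ the field with $q$ elements, and $\widehat{\mathbb{F}_q}$ the group of (complex-valued) multiplicative characters of $\mathbb{F}_q^*$. Every character $\chi$, including the trivial character $\varepsilon$, is extended to $\mathbb{F}_q$ by $\chi(0)=0$. $\overline{\chi}$ denotes the inverse of $\chi$. Products of characters are evaluated pointwise, e.g. $BC(-1)=B(-1)C(-1)$. Jacobi sum: $J(\chi,\lambda)=\sum_{u\in\mathbb{F}_q}\chi(u)\lambda(1-u)$. Binomial coefficient of characters: $\binom{A}{B}=B(-1)J(A,\overline{B})$. Finite field ${}_3F_2$: for $A_0,A_1,A_2,B_1,B_2\in\widehat{\mathbb{F}_q}$ and $x\in\mathbb{F}_q$, $${}_{3}F_2\left(\begin{matrix}A_0,A_1,A_2\\ B_1,B_2\end{matrix}\bigg|\,x\right)=\frac{1}{q-1}\sum_{\chi}\binom{A_0\chi}{\chi}\binom{A_1\chi}{B_1\chi}\binom{A_2\chi}{B_2\chi}\chi(x),$$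 the sum being over all multiplicative characters $\chi$ of $\mathbb{F}_q$. The finite field Appell series $F_2$ is defined, for $A,B,B',C,C'\in\widehat{\mathbb{F}_q}$ and $x,y\in\mathbb{F}_q$, by $$F_{2}(A;B,B';C,C';x,y)=\varepsilon(xy)\,BB'CC'(-1)\sum_{u,v\in\mathbb{F}_q}B(u)B'(v)\,\overline{B}C(1-u)\,\overline{B'}C'(1-v)\,\overline{A}(1-ux-vy).$$ *)

theory Defs
  imports Complex_Main "HOL-Library.Cardinality" "HOL-Library.Function_Division" "HOL-Library.FuncSet"
begin

text \<open>
  The field with \<open>q\<close> elements is a type \<open>'a\<close> of sort \<open>{field, finite}\<close>, with \<open>q = CARD('a)\<close>.
  A multiplicative character is a homomorphism from the nonzero elements to the nonzero complex
  numbers, extended by \<open>0 \<mapsto> 0\<close>. With this convention the product and the inverse of characters are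
  the pointwise \<open>*\<close> and \<open>inverse\<close> on functions (recall \<open>inverse 0 = 0\<close>). The neutral element is
  \<open>triv_char\<close>, not the constant function \<open>1\<close>.
\<close>

definition mult_chars :: "('a::{field,finite} \<Rightarrow> complex) set" where
  "mult_chars = {\<chi>. \<chi> 0 = 0 \<and> (\<forall>x. x \<noteq> 0 \<longrightarrow> \<chi> x \<noteq> 0) \<and>
     (\<forall>x y. x \<noteq> 0 \<longrightarrow> y \<noteq> 0 \<longrightarrow> \<chi> (x * y) = \<chi> x * \<chi> y)}"

definition triv_char :: "'a::{field,finite} \<Rightarrow> complex" where
  "triv_char x = (if x = 0 then 0 else 1)"

definition jacobi_sum :: "('a::{field,finite} \<Rightarrow> complex) \<Rightarrow> ('a \<Rightarrow> complex) \<Rightarrow> complex" where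
  "jacobi_sum \<chi> \<psi> = (\<Sum>u\<in>UNIV. \<chi> u * \<psi> (1 - u))"

definition char_binom :: "('a::{field,finite} \<Rightarrow> complex) \<Rightarrow> ('a \<Rightarrow> complex) \<Rightarrow> complex" where
  "char_binom A B = B (-1) * jacobi_sum A (inverse B)"

definition hyp_3F2 ::
  "('a::{field,finite} \<Rightarrow> complex) \<Rightarrow> ('a \<Rightarrow> complex) \<Rightarrow> ('a \<Rightarrow> complex) \<Rightarrow>
   ('a \<Rightarrow> complex) \<Rightarrow> ('a \<Rightarrow> complex) \<Rightarrow> 'a \<Rightarrow> complex" where
  "hyp_3F2 A0 A1 A2 B1 B2 x =
     1 / (of_nat CARD('a) - 1) *
     (\<Sum>\<chi>\<in>mult_chars. char_binom (A0 * \<chi>) \<chi> * char_binom (A1 * \<chi>) (B1 * \<chi>) *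
                      char_binom (A2 * \<chi>) (B2 * \<chi>) * \<chi> x)"

definition appell_F2 ::
  "('a::{field,finite} \<Rightarrow> complex) \<Rightarrow> ('a \<Rightarrow> complex) \<Rightarrow> ('a \<Rightarrow> complex) \<Rightarrow>
   ('a \<Rightarrow> complex) \<Rightarrow> ('a \<Rightarrow> complex) \<Rightarrow> 'a \<Rightarrow> 'a \<Rightarrow> complex" where
  "appell_F2 A B B' C C' x y =
     triv_char (x * y) * (B * B' * C * C') (-1) *
     (\<Sum>u\<in>UNIV. \<Sum>v\<in>UNIV. B u * B' v * (inverse B * C) (1 - u) *
        (inverse B' * C') (1 - v) * inverse A (1 - u * x - v * y))"

lemma triv_char_mult_chars: "triv_char \<in> mult_chars"
  by (auto simp: mult_chars_def triv_char_def)

lemma times_mult_chars: "A \<in> mult_chars \<Longrightarrow> B \<in> mult_chars \<Longrightarrow> A * B \<in> mult_chars"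
  by (auto simp: mult_chars_def)

lemma inverse_mult_chars: "A \<in> mult_chars \<Longrightarrow> inverse A \<in> mult_chars"
  by (auto simp: mult_chars_def)

lemma mult_chars_right_inverse: "A \<in> mult_chars \<Longrightarrow> A * inverse A = triv_char"
  by (auto simp: mult_chars_def triv_char_def fun_eq_iff)

lemma mult_chars_right_neutral: "A \<in> mult_chars \<Longrightarrow> A * triv_char = A"
  by (auto simp: mult_chars_def triv_char_def fun_eq_iff)

text \<open>Finiteness of the character group, so that the sum in \<open>hyp_3F2\<close> is a genuine one.\<close>

lemma finite_mult_chars: "finite (mult_chars :: ('a::{field,finite} \<Rightarrow> complex) set)"
proof -
  let ?R = "insert 0 (\<Union>n\<in>{0<..CARD('a)}. {z::complex. z ^ n = 1})"
  have fin: "finite ?R" by (auto intro!: finite_roots_unity)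
  have "\<chi> x \<in> ?R" if chi: "\<chi> \<in> mult_chars" for \<chi> :: "'a \<Rightarrow> complex" and x
  proof (cases "x = 0")
    case True
    then show ?thesis using chi by (simp add: mult_chars_def)
  next
    case False
    have "\<not> inj_on (\<lambda>i. x ^ i) {..CARD('a)}"
    proof
      assume "inj_on (\<lambda>i. x ^ i) {..CARD('a)}"
      from card_inj_on_le[OF this, of UNIV] show False by simp
    qed
    then obtain i j where ij: "i < j" "j \<le> CARD('a)" "x ^ i = x ^ j"
      using linorder_inj_onI'[of "{..CARD('a)}" "\<lambda>i. x ^ i"] by auto
    have "x ^ i * x ^ (j - i) = x ^ i * 1"
      using ij power_add[of x i "j - i"] by simp
    then have x1: "x ^ (j - i) = 1" using False by simp
    have mult: "\<chi> (a * b) = \<chi> a * \<chi> b" if "a \<noteq> 0" "b \<noteq> 0" for a b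
      using chi that by (simp add: mult_chars_def)
    have "\<chi> 1 * \<chi> 1 = \<chi> 1 * 1" using mult[of 1 1] by simp
    then have one: "\<chi> 1 = 1" using chi by (simp add: mult_chars_def)
    have "\<chi> (x ^ n) = \<chi> x ^ n" for n
      by (induction n) (auto simp: one mult False)
    from this[of "j - i"] x1 one have "\<chi> x ^ (j - i) = 1" by simp
    moreover have "j - i \<in> {0<..CARD('a)}" using ij by simp
    ultimately show ?thesis by blast
  qed
  then have "mult_chars \<subseteq> Pi\<^sub>E (UNIV :: 'a set) (\<lambda>_. ?R)"
    by (auto simp: PiE_UNIV_domain)
  then show ?thesis
    by (rule finite_subset) (rule finite_PiE[OF finite fin])
qed

end

theory Submission
  imports Defs "HOL-Algebra.Algebraic_Closure_Type"
begin

text \<open>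
  The symmetry swaps the two summations. For \<open>y = 1\<close> the terms with \<open>v = 1\<close> vanish, so one may write
  \<open>1 - u x - v = (1 - v) (1 - u x / (1 - v))\<close> and expand the value of the inverse of \<open>A\<close> at the second
  factor by the finite field binomial theorem, a consequence of the orthogonality relation for
  characters. The sum over \<open>u\<close> and \<open>v\<close> then splits into a product of two Jacobi sums, which the
  substitution \<open>u \<mapsto> u / (u - 1)\<close> turns into the binomial coefficients of the \<open>3F2\<close> series. The
  case \<open>x = 1\<close> follows by symmetry.
\<close>

section \<open>Arithmetic of characters extended by zero\<close>

lemma mult_char_nonzero: "\<chi> \<in> mult_chars \<Longrightarrow> x \<noteq> 0 \<Longrightarrow> \<chi> x \<noteq> 0"
  by (simp add: mult_chars_def)

lemma mult_char_zero: "\<chi> \<in> mult_chars \<Longrightarrow> \<chi> 0 = 0"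
  by (simp add: mult_chars_def)

text \<open>Extension by zero keeps a character multiplicative on the whole field, so later
  rewriting needs no side conditions. Since \<open>inverse 0 = 0\<close>, the same holds for
  inverses and quotients.\<close>

lemma mult_char_mult: "\<chi> \<in> mult_chars \<Longrightarrow> \<chi> (x * y) = \<chi> x * \<chi> y"
  by (cases "x = 0 \<or> y = 0") (auto simp: mult_chars_def)

lemma mult_char_one: "\<chi> \<in> mult_chars \<Longrightarrow> \<chi> 1 = 1"
  using mult_char_mult[of \<chi> 1 1] mult_char_nonzero[of \<chi> 1] by simp

lemma mult_char_inverse: "\<chi> \<in> mult_chars \<Longrightarrow> \<chi> (inverse x) = inverse (\<chi> x)"
  using mult_char_mult[of \<chi> x "inverse x"] mult_char_one[of \<chi>]
  by (cases "x = 0") (simp_all add: mult_char_zero field_simps mult_char_nonzero)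

lemma mult_char_divide: "\<chi> \<in> mult_chars \<Longrightarrow> \<chi> (x / y) = \<chi> x / \<chi> y"
  by (simp add: divide_inverse mult_char_mult mult_char_inverse)

lemma mult_char_minus: "\<chi> \<in> mult_chars \<Longrightarrow> \<chi> (- x) = \<chi> (- 1) * \<chi> x"
  using mult_char_mult[of \<chi> "-1" x] by simp

lemma mult_char_minus_one_square: "\<chi> \<in> mult_chars \<Longrightarrow> \<chi> (- 1) * \<chi> (- 1) = 1"
  using mult_char_mult[of \<chi> "-1" "-1"] by (simp add: mult_char_one)

lemma mult_char_inverse_minus_one: "\<chi> \<in> mult_chars \<Longrightarrow> inverse (\<chi> (- 1)) = \<chi> (- 1)"
  using mult_char_inverse[of \<chi> "-1"] by simp

text \<open>Pointwise, \<open>\<psi> * inverse \<psi>\<close> is \<open>triv_char\<close> and not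
  the constant 1. Cancellation survives because the remaining factor \<open>\<chi>\<close> itself
  vanishes at 0.\<close>

lemma mult_char_cancel:
  assumes "\<psi> \<in> mult_chars" "\<chi> \<in> mult_chars"
  shows "\<psi> * (inverse \<psi> * \<chi>) = \<chi>" "inverse \<psi> * (\<psi> * \<chi>) = \<chi>"
proof -
  have "\<psi> x * (inverse (\<psi> x) * \<chi> x) = \<chi> x" "inverse (\<psi> x) * (\<psi> x * \<chi> x) = \<chi> x" for x
    using mult_char_zero[OF assms(2)] mult_char_nonzero[OF assms(1), of x]
    by (cases "x = 0"; simp)+
  then show "\<psi> * (inverse \<psi> * \<chi>) = \<chi>" "inverse \<psi> * (\<psi> * \<chi>) = \<chi>"
    by (simp_all add: fun_eq_iff)
qed

section \<open>A primitive element and a faithful character\<close>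

lemma card_field_gt_one: "CARD('a::{field,finite}) > 1"
  using card_mono[of UNIV "{0, 1 :: 'a}"] by simp

text \<open>Stated for monoids because it serves both the generator of the field and the complex
  root of unity.\<close>

lemma power_mod_period:
  assumes "z ^ n = (1 :: 'b::monoid_mult)"
  shows "z ^ i = z ^ (i mod n)"
proof -
  have "z ^ i = z ^ (n * (i div n) + i mod n)" by simp
  also have "\<dots> = z ^ (i mod n)" by (simp only: power_add power_mult assms power_one mult_1)
  finally show ?thesis .
qed

text \<open>The type is viewed as a record-based field, whose multiplicative group is known to be
  cyclic.\<close>

lemma obtain_primitive_element:
  obtains g :: "'a::{field,finite}"
    where "g ^ (CARD('a) - 1) = 1" "bij_betw (\<lambda>i. g ^ i) {..<CARD('a) - 1} (UNIV - {0})"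
proof -
  let ?R = "ring_of_type_algebra :: 'a ring" and ?n = "CARD('a) - 1"
  interpret R: field ?R by (rule field_from_type_algebra)
  have carr: "carrier ?R = UNIV" and zero: "\<zero>\<^bsub>?R\<^esub> = 0" and one: "\<one>\<^bsub>?R\<^esub> = 1"
    by (simp_all add: ring_of_type_algebra_def)
  have pow: "x [^]\<^bsub>?R\<^esub> (i::nat) = x ^ i" for x :: 'a and i
    by (induction i) (simp_all add: R.nat_pow_Suc ring_of_type_algebra_def mult.commute)
  obtain g :: 'a where g: "g \<noteq> 0" "UNIV - {0} = range (\<lambda>i. g ^ i)"
    using R.finite_field_mult_group_has_gen by (auto simp: carr zero pow full_SetCompr_eq)
  have g1: "g ^ ?n = 1"
    using group.pow_order_eq_1[OF R.field_mult_group, of g] g(1)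
    by (simp add: Coset.order_def carr zero one pow Multiplicative_Group.nat_pow_mult_of
        card_Diff_singleton)
  have "(\<lambda>i. g ^ i) ` {..<?n} = UNIV - {0}"
  proof
    show "(\<lambda>i. g ^ i) ` {..<?n} \<subseteq> UNIV - {0}" using g by auto
    show "UNIV - {0} \<subseteq> (\<lambda>i. g ^ i) ` {..<?n}"
    proof
      fix x assume "x \<in> UNIV - {0 :: 'a}"
      then obtain i where x: "x = g ^ i" using g by auto
      have "g ^ i = g ^ (i mod ?n)"
        by (rule power_mod_period[OF g1])
      moreover have "i mod ?n < ?n"
        using card_field_gt_one[where 'a = 'a] by simp
      ultimately show "x \<in> (\<lambda>i. g ^ i) ` {..<?n}" using x by auto
    qed
  qed
  \<comment> \<open>The map is onto a set with as many elements as its domain, so it is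
    injective.\<close>
  moreover have "card (UNIV - {0 :: 'a}) = ?n" by (simp add: card_Diff_singleton)
  ultimately have "bij_betw (\<lambda>i. g ^ i) {..<?n} (UNIV - {0})"
    by (simp add: bij_betw_def eq_card_imp_inj_on)
  with g1 show ?thesis by (rule that)
qed

text \<open>The character sends a primitive element to \<open>w\<close>, a primitive root of unity
  of order q - 1. Here \<open>l\<close> is the discrete logarithm. Faithfulness holds because the
  powers of \<open>w\<close> with exponents below q - 1 are distinct.\<close>

lemma obtain_faithful_mult_char:
  obtains \<chi> :: "'a::{field,finite} \<Rightarrow> complex"
    where "\<chi> \<in> mult_chars" "\<And>x. \<chi> x = 1 \<Longrightarrow> x = 1"
proof -
  let ?n = "CARD('a) - 1"
  obtain g :: 'a
    where g: "g ^ ?n = 1" "bij_betw (\<lambda>i. g ^ i) {..<?n} (UNIV - {0})"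
    by (rule obtain_primitive_element)
  define l where "l = inv_into {..<?n} (\<lambda>i. g ^ i)"
  define w where "w = cis (2 * pi / ?n)"
  define \<chi> where "\<chi> = (\<lambda>x::'a. if x = 0 then 0 else w ^ l x)"
  have l: "g ^ l x = x" "l x < ?n" if "x \<noteq> 0" for x
    using that g(2) unfolding l_def bij_betw_def
    by (auto intro!: f_inv_into_f inv_into_into[of x "\<lambda>i. g ^ i" "{..<?n}", simplified])
  have n: "?n > 0" using card_field_gt_one[where 'a = 'a] by simp
  have w: "w ^ ?n = 1"
    using n by (simp add: w_def DeMoivre)
  have "\<chi> (x * y) = \<chi> x * \<chi> y" if "x \<noteq> 0" "y \<noteq> 0" for x y
  proof -
    \<comment> \<open>The logarithm is additive only modulo q - 1, which is harmless because
      \<open>w\<close> has the same period.\<close>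
    have "g ^ l (x * y) = g ^ ((l x + l y) mod ?n)"
      using l(1)[of "x * y"] l(1)[OF that(1)] l(1)[OF that(2)]
        power_mod_period[OF g(1), of "l x + l y"] that
      by (simp add: power_add)
    then have "l (x * y) = (l x + l y) mod ?n"
      by (rule inj_onD[OF bij_betw_imp_inj_on[OF g(2)]])
        (use that n l(2)[of "x * y"] in simp_all)
    then show ?thesis
      using that power_mod_period[OF w, of "l x + l y"] by (simp add: \<chi>_def power_add)
  qed
  then have "\<chi> \<in> mult_chars" by (auto simp: mult_chars_def \<chi>_def w_def)
  moreover have "x = 1" if "\<chi> x = 1" for x
  proof -
    have x: "x \<noteq> 0" "w ^ l x = 1" using that by (auto simp: \<chi>_def split: if_splits)
    have "cis (2 * pi * real (l x) / real ?n) = cis (2 * pi * real 0 / real ?n)"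
      using x(2) by (simp add: w_def DeMoivre mult.commute)
    then have "l x = 0"
      by (rule inj_onD[OF bij_betw_imp_inj_on[OF bij_betw_roots_unity[OF n]]])
        (use x(1) l(2)[of x] n in simp_all)
    then show ?thesis using l(1)[of x] x(1) by simp
  qed
  ultimately show ?thesis by (rule that)
qed

section \<open>Orthogonality relations\<close>

lemma sum_mult_char:
  assumes "\<chi> \<in> mult_chars"
  shows "(\<Sum>x\<in>UNIV. \<chi> (x :: 'a::{field,finite}))
    = (if \<chi> = triv_char then of_nat CARD('a) - 1 else 0)"
proof (cases "\<chi> = triv_char")
  case True
  have "(\<Sum>x\<in>UNIV. triv_char (x :: 'a)) = (\<Sum>x\<in>UNIV - {0 :: 'a}. 1)"
    by (rule sum.mono_neutral_cong_right) (auto simp: triv_char_def)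
  also have "\<dots> = of_nat (CARD('a) - 1)"
    by (simp add: card_Diff_singleton)
  finally show ?thesis using True by (simp add: of_nat_diff)
next
  case False
  then obtain a where a: "a \<noteq> 0" "\<chi> a \<noteq> 1"
    using mult_char_zero[OF assms] by (auto simp: triv_char_def fun_eq_iff split: if_splits)
  \<comment> \<open>Multiplication by \<open>a\<close> permutes the field and scales the sum by
    \<open>\<chi> a\<close>, which differs from 1, so the sum is 0.\<close>
  have "(\<Sum>x\<in>UNIV. \<chi> x) = (\<Sum>x\<in>UNIV. \<chi> (a * x))"
    by (rule sum.reindex_bij_witness[of _ "\<lambda>x. a * x" "\<lambda>x. x / a"]) (use a in auto)
  also have "\<dots> = \<chi> a * (\<Sum>x\<in>UNIV. \<chi> x)"
    by (simp add: mult_char_mult[OF assms] sum_distrib_left)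
  finally show ?thesis using a False by simp
qed

text \<open>This is the dual argument: multiplication by a character \<open>\<psi>\<close> with
  \<open>\<psi> t\<close> different from 1 permutes the characters. The faithful character supplies
  such a \<open>\<psi>\<close>.\<close>

lemma sum_mult_chars_at_nontrivial:
  assumes "t \<noteq> 0" "t \<noteq> 1"
  shows "(\<Sum>\<chi>\<in>mult_chars. \<chi> (t :: 'a::{field,finite})) = 0"
proof -
  obtain \<psi> :: "'a \<Rightarrow> complex" where \<psi>: "\<psi> \<in> mult_chars" "\<psi> t \<noteq> 1"
    using assms by (metis obtain_faithful_mult_char)
  have "(\<Sum>\<chi>\<in>mult_chars. \<chi> t) = (\<Sum>\<chi>\<in>mult_chars. (\<psi> * \<chi>) t)"
    by (rule sum.reindex_bij_witness[of _ "\<lambda>\<chi>. \<psi> * \<chi>" "\<lambda>\<chi>. inverse \<psi> * \<chi>"])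
      (use \<psi>(1) in \<open>simp_all add: times_mult_chars inverse_mult_chars mult_char_cancel\<close>)
  also have "\<dots> = \<psi> t * (\<Sum>\<chi>\<in>mult_chars. \<chi> t)"
    by (simp add: sum_distrib_left)
  finally show ?thesis using \<psi> by simp
qed

text \<open>At \<open>t = 1\<close> this counts the characters. The count comes from summing all
  values \<open>\<chi> x\<close> in two orders: only \<open>x = 1\<close> contributes in one, only
  \<open>triv_char\<close> in the other.\<close>

lemma sum_mult_chars:
  assumes "t \<noteq> 0"
  shows "(\<Sum>\<chi>\<in>mult_chars. \<chi> (t :: 'a::{field,finite}))
    = (if t = 1 then of_nat CARD('a) - 1 else 0)"
proof (cases "t = 1")
  case True
  have "(\<Sum>\<chi>\<in>mult_chars. \<chi> (1 :: 'a))
      = (\<Sum>x\<in>UNIV. if x = (1 :: 'a) then (\<Sum>\<chi>\<in>mult_chars. \<chi> (1 :: 'a)) else 0)"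
    by simp
  also have "\<dots> = (\<Sum>x\<in>UNIV. \<Sum>\<chi>\<in>mult_chars. \<chi> (x :: 'a))"
  proof (rule sum.cong[OF refl])
    fix x :: 'a
    show "(if x = 1 then \<Sum>\<chi>\<in>mult_chars. \<chi> (1 :: 'a) else 0) = (\<Sum>\<chi>\<in>mult_chars. \<chi> x)"
      by (cases "x = 0") (simp_all add: mult_char_zero sum_mult_chars_at_nontrivial)
  qed
  also have "\<dots> = (\<Sum>\<chi>\<in>mult_chars. \<Sum>x\<in>UNIV. \<chi> (x :: 'a))"
    by (rule sum.swap)
  also have "\<dots> = (\<Sum>\<chi>\<in>mult_chars. if \<chi> = (triv_char :: 'a \<Rightarrow> complex) then of_nat CARD('a) - 1 else 0)"
    by (intro sum.cong refl sum_mult_char)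
  also have "\<dots> = of_nat CARD('a) - 1"
    by (simp add: finite_mult_chars triv_char_mult_chars)
  finally show ?thesis using True by simp
qed (use assms sum_mult_chars_at_nontrivial in auto)

text \<open>Greene's finite field binomial theorem; at \<open>t = 0\<close> it would need a correction term.\<close>

lemma finite_field_binomial:
  assumes A: "A \<in> mult_chars" and t: "t \<noteq> (0 :: 'a::{field,finite})"
  shows "(\<Sum>\<chi>\<in>mult_chars. char_binom (A * \<chi>) \<chi> * \<chi> t)
    = (of_nat CARD('a) - 1) * inverse A (1 - t)"
proof -
  have "(\<Sum>\<chi>\<in>mult_chars. char_binom (A * \<chi>) \<chi> * \<chi> t)
      = (\<Sum>\<chi>\<in>mult_chars. \<Sum>u\<in>UNIV. A u * \<chi> (- t * u / (1 - u)))"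
  proof (rule sum.cong[OF refl])
    fix \<chi> :: "'a \<Rightarrow> complex" assume chi: "\<chi> \<in> mult_chars"
    have "\<chi> (- t * u / (1 - u)) = \<chi> (- 1) * \<chi> t * \<chi> u / \<chi> (1 - u)" for u
      using mult_char_minus[OF chi, of "t * u / (1 - u)"] chi
      by (simp add: mult_char_mult mult_char_divide)
    then show "char_binom (A * \<chi>) \<chi> * \<chi> t = (\<Sum>u\<in>UNIV. A u * \<chi> (- t * u / (1 - u)))"
      by (simp add: char_binom_def jacobi_sum_def sum_distrib_left sum_distrib_right
          divide_inverse mult_ac)
  qed
  also have "\<dots> = (\<Sum>u\<in>UNIV. A u * (\<Sum>\<chi>\<in>mult_chars. \<chi> (- t * u / (1 - u))))"
    by (subst sum.swap) (simp add: sum_distrib_left)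
  \<comment> \<open>Orthogonality keeps only the \<open>u\<close> with
    \<open>- t * u / (1 - u) = 1\<close>. For \<open>t = 1\<close> there is none; then
    \<open>inverse (1 - t)\<close> is 0 and the term kept vanishes because
    \<open>A 0 = 0\<close>.\<close>
  also have "\<dots> = (\<Sum>u\<in>UNIV. if u = inverse (1 - t) then (of_nat CARD('a) - 1) * A u else 0)"
  proof (rule sum.cong[OF refl])
    fix u :: 'a
    consider "u = 0" | "u = 1" | "u \<noteq> 0" "u \<noteq> 1" by blast
    then show "A u * (\<Sum>\<chi>\<in>mult_chars. \<chi> (- t * u / (1 - u)))
        = (if u = inverse (1 - t) then (of_nat CARD('a) - 1) * A u else 0)"
    proof cases
      case 1
      then show ?thesis using A by (simp add: mult_char_zero)
    next
      case 2
      \<comment> \<open>At \<open>u = 1\<close> the quotient has denominator 0 and so equals 0,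
        where every character vanishes. The right-hand side must vanish too, which uses that
        \<open>t\<close> is nonzero.\<close>
      have "inverse (1 - t) \<noteq> 1" using t by simp
      then show ?thesis using 2 by (auto simp: mult_char_zero)
    next
      case 3
      have "u * (1 - t) = 1 \<longleftrightarrow> u = inverse (1 - t)"
        by (cases "t = 1") (use 3 in \<open>auto simp: field_simps\<close>)
      moreover have "- t * u / (1 - u) = 1 \<longleftrightarrow> u * (1 - t) = 1"
      proof -
        have "- t * u / (1 - u) = 1 \<longleftrightarrow> - t * u = 1 - u" using 3 by (subst nonzero_divide_eq_eq) auto
        also have "\<dots> \<longleftrightarrow> u * (1 - t) = 1" by (simp add: eq_diff_eq right_diff_distrib mult.commute)
        finally show ?thesis .
      qed
      ultimately show ?thesis using 3 t sum_mult_chars[of "- t * u / (1 - u)"] by simp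
    qed
  qed
  also have "\<dots> = (of_nat CARD('a) - 1) * inverse A (1 - t)"
    by (simp add: mult_char_inverse[OF A])
  finally show ?thesis .
qed

section \<open>Jacobi sums as binomial coefficients\<close>

lemma jacobi_sum_commute: "jacobi_sum \<chi> \<psi> = jacobi_sum \<psi> \<chi>"
  unfolding jacobi_sum_def
  by (rule sum.reindex_bij_witness[of _ "\<lambda>u. 1 - u" "\<lambda>u. 1 - u"]) (auto simp: mult.commute)

lemma jacobi_sum_transform:
  assumes A: "A \<in> mult_chars" and B: "B \<in> mult_chars"
  shows "jacobi_sum A B = A (- 1) * jacobi_sum A (inverse (A * B))"
proof -
  have "jacobi_sum A B = (\<Sum>u\<in>UNIV - {1}. A u * B (1 - u))"
    unfolding jacobi_sum_def by (rule sum.mono_neutral_right) (auto simp: mult_char_zero[OF B])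
  also have "\<dots> = (\<Sum>u\<in>UNIV - {1}. A (- 1) * (A u * inverse (A * B) (1 - u)))"
  \<comment> \<open>The substitution is an involution of the field without 1, so it is its own
    inverse witness. The terms at \<open>u = 1\<close> vanish on both sides.\<close>
  proof (rule sum.reindex_bij_witness[of _ "\<lambda>u. u / (u - 1)" "\<lambda>u. u / (u - 1)"])
    fix u :: 'a assume "u \<in> UNIV - {1}"
    then have u: "u - 1 \<noteq> 0" by simp
    show "u / (u - 1) / (u / (u - 1) - 1) = u" using u by (simp add: field_simps)
    show "u / (u - 1) \<in> UNIV - {1}" using u by (simp add: field_simps)
    show "u / (u - 1) / (u / (u - 1) - 1) = u" using u by (simp add: field_simps)
    show "u / (u - 1) \<in> UNIV - {1}" using u by (simp add: field_simps)
    have 1: "1 - u / (u - 1) = 1 / (1 - u)" using u by (simp add: field_simps)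
    have 2: "A (u / (u - 1)) = A (- 1) * (A u / A (1 - u))"
      using mult_char_minus[OF A, of "u / (1 - u)"] u
      by (simp add: mult_char_divide[OF A] minus_divide_right)
    have "A (- 1) * (A (u / (u - 1)) * inverse (A * B) (1 - u / (u - 1))) = A u * B (1 - u)"
      using u mult_char_nonzero[OF A, of "1 - u"] mult_char_minus_one_square[OF A]
      unfolding 1 2 by (simp add: mult_char_divide A B mult_char_one field_simps)
    then show "A (- 1) * (A (u / (u - 1)) * inverse (A * B) (1 - u / (u - 1))) = A u * B (1 - u)" .
  qed
  also have "\<dots> = (\<Sum>u\<in>UNIV. A (- 1) * (A u * inverse (A * B) (1 - u)))"
    by (rule sum.mono_neutral_left) (auto simp: mult_char_zero A)
  finally show ?thesis by (simp add: jacobi_sum_def sum_distrib_left)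
qed

text \<open>Transforming with respect to \<open>A\<close> keeps \<open>A\<close> as the upper
  parameter. This form suits the sum over \<open>u\<close>, where the summation character sits in
  the first argument.\<close>

lemma jacobi_sum_eq_char_binom:
  assumes "A \<in> mult_chars" "B \<in> mult_chars"
  shows "jacobi_sum A B = B (- 1) * char_binom A (A * B)"
proof -
  have "char_binom A (A * B) = B (- 1) * (A (- 1) * jacobi_sum A (inverse (A * B)))"
    by (simp add: char_binom_def)
  also have "\<dots> = B (- 1) * jacobi_sum A B"
    using jacobi_sum_transform[OF assms] by simp
  finally show ?thesis
    using mult_char_minus_one_square[OF assms(2)] by (simp flip: mult.assoc)
qed

text \<open>Transforming with respect to \<open>B\<close> instead moves the product into the upper
  parameter. This form suits the sum over \<open>v\<close>, where the summation character occurs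
  inverted in the second argument only.\<close>

lemma jacobi_sum_eq_char_binom_inverse:
  assumes "A \<in> mult_chars" "B \<in> mult_chars"
  shows "jacobi_sum A B = char_binom (inverse (A * B)) (inverse B)"
proof -
  have "jacobi_sum A B = B (- 1) * jacobi_sum B (inverse (A * B))"
    using jacobi_sum_transform[OF assms(2,1)] by (simp add: jacobi_sum_commute mult.commute)
  moreover have "inverse (inverse B) = B" by (simp add: fun_eq_iff)
  ultimately show ?thesis
    using assms(2)
    by (simp add: char_binom_def mult_char_inverse_minus_one jacobi_sum_commute)
qed

section \<open>The Appell series and its reduction\<close>

lemma appell_F2_commute: "appell_F2 A B B' C C' x y = appell_F2 A B' B C' C y x"
  unfolding appell_F2_def
  by (subst sum.swap) (simp add: mult_ac diff_diff_eq add.commute)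

lemma appell_F2_one_right:
  fixes A B B' C C' :: "'a::{field,finite} \<Rightarrow> complex" and x :: 'a
  assumes A: "A \<in> mult_chars" and B: "B \<in> mult_chars" and B': "B' \<in> mult_chars"
    and C: "C \<in> mult_chars" and C': "C' \<in> mult_chars"
  shows "appell_F2 A B B' C C' x 1 =
      (B' * C') (-1) * hyp_3F2 A B (A * inverse C') C (A * B' * inverse C') x"
proof (cases "x = 0")
  \<comment> \<open>The left-hand side vanishes through \<open>triv_char\<close>, the right-hand
    side because \<open>\<chi> 0 = 0\<close>.\<close>
  case True
  then show ?thesis by (simp add: appell_F2_def hyp_3F2_def triv_char_def mult_char_zero)
next
  case x: False
  let ?q = "of_nat CARD('a) - 1 :: complex"
  have q: "?q \<noteq> 0"
    using card_field_gt_one[where 'a = 'a] by (simp add: of_nat_eq_1_iff)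
  have summand: "?q * (B u * B' v * (inverse B * C) (1 - u) * (inverse B' * C') (1 - v) *
        inverse A (1 - u * x - v * 1))
      = (\<Sum>\<chi>\<in>mult_chars. char_binom (A * \<chi>) \<chi> * \<chi> x *
          (((B * \<chi>) u * (inverse B * C) (1 - u)) *
          (B' v * inverse (A * inverse C' * \<chi> * B') (1 - v))))"
    for u v :: 'a
  \<comment> \<open>In these degenerate cases both sides vanish; otherwise
    \<open>u * x / (1 - v)\<close> is nonzero, as the binomial theorem demands.\<close>
  proof (cases "u = 0 \<or> v = 1")
    case True
    then show ?thesis using A B B' C C' by (auto simp: mult_char_zero)
  next
    case False
    then have u: "u \<noteq> 0" and v: "1 - v \<noteq> 0" by auto
    have "1 - u * x - v * 1 = (1 - v) * (1 - u * x / (1 - v))"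
      using v by (simp add: field_simps)
    then have "inverse A (1 - u * x - v * 1)
        = inverse A (1 - v) * inverse A (1 - u * x / (1 - v))"
      by (simp only: mult_char_mult[OF inverse_mult_chars[OF A]])
    then have "?q * (B u * B' v * (inverse B * C) (1 - u) * (inverse B' * C') (1 - v) *
          inverse A (1 - u * x - v * 1))
        = B u * B' v * (inverse B * C) (1 - u) * (inverse B' * C') (1 - v) * inverse A (1 - v) *
          (?q * inverse A (1 - u * x / (1 - v)))"
      by (simp only: mult_ac)
    also have "?q * inverse A (1 - u * x / (1 - v))
        = (\<Sum>\<chi>\<in>mult_chars. char_binom (A * \<chi>) \<chi> * \<chi> (u * x / (1 - v)))"
      using finite_field_binomial[OF A, of "u * x / (1 - v)"] u v x by simp
    finally show ?thesis
      by (simp only: sum_distrib_left, intro sum.cong refl)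
        (simp add: mult_char_mult mult_char_inverse divide_inverse mult_ac)
  qed
  have jac: "jacobi_sum (B * \<chi>) (inverse B * C)
        = (B * C) (- 1) * char_binom (B * \<chi>) (C * \<chi>)"
      "jacobi_sum B' (inverse (A * inverse C' * \<chi> * B'))
        = char_binom (A * inverse C' * \<chi>) (A * B' * inverse C' * \<chi>)"
    if chi: "\<chi> \<in> mult_chars" for \<chi>
  proof -
    note closed = times_mult_chars inverse_mult_chars A B B' C C' chi
    have "B * \<chi> * (inverse B * C) = C * \<chi>"
      using mult_char_cancel(1)[of B "C * \<chi>"] by (simp add: closed mult_ac)
    then show "jacobi_sum (B * \<chi>) (inverse B * C)
        = (B * C) (- 1) * char_binom (B * \<chi>) (C * \<chi>)"
      using jacobi_sum_eq_char_binom[of "B * \<chi>" "inverse B * C"]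
      by (simp add: closed mult_char_inverse_minus_one)
    have "inverse (B' * inverse (A * inverse C' * \<chi> * B'))
        = inverse B' * (B' * (A * inverse C' * \<chi>))"
      by (simp add: fun_eq_iff mult_ac)
    then have "inverse (B' * inverse (A * inverse C' * \<chi> * B')) = A * inverse C' * \<chi>"
      by (simp only: mult_char_cancel closed)
    moreover have "inverse (inverse (A * inverse C' * \<chi> * B')) = A * B' * inverse C' * \<chi>"
      by (simp add: fun_eq_iff mult_ac)
    ultimately show "jacobi_sum B' (inverse (A * inverse C' * \<chi> * B'))
        = char_binom (A * inverse C' * \<chi>) (A * B' * inverse C' * \<chi>)"
      using jacobi_sum_eq_char_binom_inverse[of B' "inverse (A * inverse C' * \<chi> * B')"]
      by (simp add: closed)
  qed
  have "?q * (\<Sum>u\<in>UNIV. \<Sum>v\<in>UNIV. B u * B' v * (inverse B * C) (1 - u) *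
        (inverse B' * C') (1 - v) * inverse A (1 - u * x - v * 1))
      = (\<Sum>u\<in>UNIV. \<Sum>v\<in>UNIV. \<Sum>\<chi>\<in>mult_chars. char_binom (A * \<chi>) \<chi> * \<chi> x *
          (((B * \<chi>) u * (inverse B * C) (1 - u)) *
          (B' v * inverse (A * inverse C' * \<chi> * B') (1 - v))))"
    by (simp only: sum_distrib_left summand)
  also have "\<dots> = (\<Sum>\<chi>\<in>mult_chars. \<Sum>u\<in>UNIV. \<Sum>v\<in>UNIV. char_binom (A * \<chi>) \<chi> * \<chi> x *
          (((B * \<chi>) u * (inverse B * C) (1 - u)) *
          (B' v * inverse (A * inverse C' * \<chi> * B') (1 - v))))"
    by (subst (2) sum.swap, subst sum.swap) (rule refl)
  also have "\<dots> = (\<Sum>\<chi>\<in>mult_chars. char_binom (A * \<chi>) \<chi> * \<chi> x *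
      (jacobi_sum (B * \<chi>) (inverse B * C) *
        jacobi_sum B' (inverse (A * inverse C' * \<chi> * B'))))"
    unfolding jacobi_sum_def sum_product by (simp only: sum_distrib_left)
  also have "\<dots> = (B * C) (- 1) * (\<Sum>\<chi>\<in>mult_chars. char_binom (A * \<chi>) \<chi> *
      char_binom (B * \<chi>) (C * \<chi>) *
      char_binom (A * inverse C' * \<chi>) (A * B' * inverse C' * \<chi>) * \<chi> x)"
    by (simp only: sum_distrib_left, intro sum.cong refl, simp only: jac) (simp add: mult_ac)
  also have "\<dots> = ?q * ((B * C) (- 1) *
      hyp_3F2 A B (A * inverse C') C (A * B' * inverse C') x)"
    using q by (simp add: hyp_3F2_def)
  finally have "appell_F2 A B B' C C' x 1 = (B * B' * C * C') (- 1) * ((B * C) (- 1) *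
      hyp_3F2 A B (A * inverse C') C (A * B' * inverse C') x)"
    using q x by (simp add: appell_F2_def triv_char_def)
  \<comment> \<open>The signs of \<open>B\<close> and \<open>C\<close> occur twice, once from the
    definition of the series and once from the sum over \<open>u\<close>, and cancel.\<close>
  also have "\<dots> = (B (- 1) * B (- 1)) * (C (- 1) * C (- 1)) * ((B' * C') (-1) *
      hyp_3F2 A B (A * inverse C') C (A * B' * inverse C') x)"
    by (simp add: mult_ac)
  finally show ?thesis
    by (simp add: mult_char_minus_one_square B C)
qed

theorem proposition1p1:
  fixes A B B' C C' :: "'a::{field,finite} \<Rightarrow> complex" and x y :: 'a
  assumes "A \<in> mult_chars" and "B \<in> mult_chars" and "B' \<in> mult_chars"
    and "C \<in> mult_chars" and "C' \<in> mult_chars"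
  shows "appell_F2 A B B' C C' x y = appell_F2 A B' B C' C y x \<and>
    appell_F2 A B B' C C' x 1 =
      (B' * C') (-1) * hyp_3F2 A B (A * inverse C') C (A * B' * inverse C') x \<and>
    appell_F2 A B B' C C' 1 y =
      (B * C) (-1) * hyp_3F2 A B' (A * inverse C) C' (A * B * inverse C) y"
  using appell_F2_commute[of A B B' C C' x y] appell_F2_commute[of A B B' C C' 1 y]
    appell_F2_one_right[of A B B' C C' x] appell_F2_one_right[of A B' B C' C y] assms by simp

end
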